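(* Let $A$ and $B$ be finite groups. Then: (1) $\rho(A\times B)$ divides $\rho(A)^{|B|}\rho(B)^{|A|}$; moreover, $\rho(A\times B)=\rho(A)^{|B|}\rho(B)^{|A|}$ if and only if $\gcd(|A|,|B|)=1$. (2) $\Omega_{\rho}(A\times B)\leq \Omega_{\rho}(A)\cdot|B|+\Omega_{\rho}(B)\cdot|A|$; moreover, equality $\Omega_{\rho}(A\times B)= \Omega_{\rho}(A)\cdot|B|+\Omega_{\rho}(B)\cdot|A|$ holds if and only if $\gcd(|A|,|B|)=1$.
   Context: For a finite group $G$, let $o(x)$ denote the order of $x\in G$ and set $\rho(G)=\prod_{x\in G} o(x)$. For a positive integer $m=p_1^{\alpha_1}\cdots p_k^{\alpha_k}$ with $p_1,\dots,p_k$ distinct primes, $\Omega(m)=\alpha_1+\cdots+\alpha_k$ is the number of prime factors of $m$ counted with multiplicity (so $\Omega(1)=0$). Define $\Omega_{\rho}(G)=\Omega(\rho(G))$. *)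

theory Defs
  imports "HOL-Algebra.Multiplicative_Group" "HOL-Computational_Algebra.Primes"
begin

definition rho :: "('a, 'm) monoid_scheme \<Rightarrow> nat" where
  "rho G = (\<Prod>x\<in>carrier G. group.ord G x)"

definition Omega :: "nat \<Rightarrow> nat" where
  "Omega m = (\<Sum>p\<in>prime_factors m. multiplicity p m)"

definition Omega_rho :: "('a, 'm) monoid_scheme \<Rightarrow> nat" where
  "Omega_rho G = Omega (rho G)"

end

theory Submission
  imports Defs "HOL-Algebra.Sylow"
begin

text \<open>
  An element \<open>(a, b)\<close> of \<open>A \<times>\<times> B\<close> has order \<open>lcm (ord a) (ord b)\<close>, and the defect between this
  least common multiple and the product of the two orders is their greatest common divisor.
  Multiplying over all pairs, the defect between \<open>rho (A \<times>\<times> B)\<close> and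
  \<open>rho A ^ order B * rho B ^ order A\<close> is exactly the integer
  \<open>D = (\<Prod>(a, b). gcd (ord a) (ord b))\<close> (lemma \<open>rho_DirProd_mult_gcds\<close>).

  Everything is read off from \<open>D\<close>. Divisibility is immediate, and equality of the products
  means \<open>D = 1\<close>. Since \<open>Omega\<close> turns products into sums and vanishes only at \<open>1\<close>, the
  inequality between the \<open>Omega_rho\<close> is immediate as well, and equality there again means
  \<open>D = 1\<close>. Finally \<open>D = 1\<close> says that every element order in \<open>A\<close> is coprime to every element
  order in \<open>B\<close>; by the theorems of Lagrange and Cauchy the element orders of a finite group have
  the same prime divisors as the group order, so this is coprimality of the group orders
  (lemma \<open>coprime_orders_iff_coprime_ords\<close>).
\<close>

lemma Omega_eq_size: "Omega m = size (prime_factorization m)"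
  unfolding Omega_def size_multiset_overloaded_eq
  by (intro sum.cong) (auto simp: count_prime_factorization_prime in_prime_factors_iff)

lemma Omega_eq_0_iff: "m \<noteq> 0 \<Longrightarrow> Omega m = 0 \<longleftrightarrow> m = 1"
  by (simp add: Omega_eq_size prime_factorization_empty_iff)

lemma Omega_mult: "m \<noteq> 0 \<Longrightarrow> n \<noteq> 0 \<Longrightarrow> Omega (m * n) = Omega m + Omega n"
  by (simp add: Omega_eq_size prime_factorization_mult)

lemma Omega_power: "m \<noteq> 0 \<Longrightarrow> Omega (m ^ k) = Omega m * k"
  by (induction k) (simp_all add: Omega_mult Omega_eq_0_iff)

lemma nat_pow_DirProd:
  "(a, b) [^]\<^bsub>A \<times>\<times> B\<^esub> (n::nat) = (a [^]\<^bsub>A\<^esub> n, b [^]\<^bsub>B\<^esub> n)"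
  by (induction n) (simp_all add: nat_pow_def)

lemma ord_DirProd:
  assumes "group A" "group B" "a \<in> carrier A" "b \<in> carrier B"
  shows "group.ord (A \<times>\<times> B) (a, b) = lcm (group.ord A a) (group.ord B b)"
  using assms
  by (simp add: group.ord_unique[OF DirProd_group] nat_pow_DirProd group.pow_eq_id)

lemma rho_neq_0:
  assumes "group G" "finite (carrier G)"
  shows "rho G \<noteq> 0"
  using assms group.ord_ge_1[OF assms] by (fastforce simp: rho_def)

lemma rho_DirProd_mult_gcds:
  assumes "group A" "group B" "finite (carrier A)" "finite (carrier B)"
  shows "rho (A \<times>\<times> B) * (\<Prod>(a, b)\<in>carrier A \<times> carrier B. gcd (group.ord A a) (group.ord B b))
       = rho A ^ order B * rho B ^ order A"
proof -
  have "rho (A \<times>\<times> B) * (\<Prod>(a, b)\<in>carrier A \<times> carrier B. gcd (group.ord A a) (group.ord B b))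
      = (\<Prod>(a, b)\<in>carrier A \<times> carrier B. group.ord A a * group.ord B b)"
    unfolding rho_def carrier_DirProd prod.distrib[symmetric]
    by (intro prod.cong) (auto simp: ord_DirProd assms)
  also have "\<dots> = rho A ^ order B * rho B ^ order A"
    by (simp add: rho_def order_def prod.distrib prod_power_distrib[symmetric]
        flip: prod.cartesian_product)
  finally show ?thesis .
qed

text \<open>
  Cauchy's theorem: the case of exponent one in Sylow's theorem provides a subgroup of order
  \<open>p\<close>, and each of its elements other than the identity has order \<open>p\<close>.
\<close>

lemma (in group) exists_ord_eq_prime:
  assumes fin: "finite (carrier G)" and p: "prime p" "p dvd order G"
  obtains x where "x \<in> carrier G" "ord x = p"
proof -
  from p obtain m where "order G = p ^ 1 * m" by (auto elim: dvdE)
  then obtain H where H: "subgroup H G" "card H = p"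
    using sylow_thm[OF p(1) is_group _ fin, of 1 m] by auto
  interpret H: group "G\<lparr>carrier := H\<rparr>" by (rule subgroup_imp_group[OF H(1)])
  have "\<one> \<in> H" by (rule subgroup.one_closed[OF H(1)])
  moreover have "H \<noteq> {\<one>}" using H(2) p(1) by auto
  ultimately obtain x where x: "x \<in> H" "x \<noteq> \<one>" by blast
  have xG: "x \<in> carrier G" by (rule subgroup.mem_carrier[OF H(1) x(1)])
  have "x [^] p = \<one>"
    using H.pow_order_eq_1[of x] x(1) H(2) nat_pow_consistent[of x p H] by (simp add: order_def)
  then have "ord x dvd p" using pow_eq_id[OF xG] by simp
  moreover have "ord x \<noteq> 1" using ord_eq_1[OF xG] x(2) by simp
  ultimately have "ord x = p" using p(1) by (auto simp: prime_nat_iff)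
  with xG that show thesis by blast
qed

lemma coprime_orders_iff_coprime_ords:
  assumes A: "group A" "finite (carrier A)" and B: "group B" "finite (carrier B)"
  shows "coprime (order A) (order B) \<longleftrightarrow>
    (\<forall>a\<in>carrier A. \<forall>b\<in>carrier B. coprime (group.ord A a) (group.ord B b))"
proof (intro iffI ballI)
  fix a b assume "coprime (order A) (order B)" "a \<in> carrier A" "b \<in> carrier B"
  then show "coprime (group.ord A a) (group.ord B b)"
    using group.ord_dvd_group_order[OF A(1)] group.ord_dvd_group_order[OF B(1)]
    by (meson coprime_divisors)
next
  assume ords: "\<forall>a\<in>carrier A. \<forall>b\<in>carrier B. coprime (group.ord A a) (group.ord B b)"
  show "coprime (order A) (order B)"
  proof (rule ccontr)
    assume "\<not> coprime (order A) (order B)"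
    then obtain p where p: "prime p" "p dvd order A" "p dvd order B"
      using prime_factor_nat[of "gcd (order A) (order B)"] by (auto simp: coprime_iff_gcd_eq_1)
    obtain a where "a \<in> carrier A" "group.ord A a = p"
      using group.exists_ord_eq_prime[OF A p(1,2)] .
    moreover obtain b where "b \<in> carrier B" "group.ord B b = p"
      using group.exists_ord_eq_prime[OF B p(1,3)] .
    ultimately have "coprime p p" using ords by metis
    with p(1) show False by simp
  qed
qed

theorem lemma2p8:
  fixes A :: "('a, 'm) monoid_scheme" and B :: "('b, 'n) monoid_scheme"
  assumes "group A" and "finite (carrier A)"
    and "group B" and "finite (carrier B)"
  shows "(rho (A \<times>\<times> B) dvd rho A ^ order B * rho B ^ order A \<and>
          (rho (A \<times>\<times> B) = rho A ^ order B * rho B ^ order A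
             \<longleftrightarrow> gcd (order A) (order B) = 1)) \<and>
         (Omega_rho (A \<times>\<times> B) \<le> Omega_rho A * order B + Omega_rho B * order A \<and>
          (Omega_rho (A \<times>\<times> B) = Omega_rho A * order B + Omega_rho B * order A
             \<longleftrightarrow> gcd (order A) (order B) = 1))"
proof -
  define D where
    "D = (\<Prod>(a, b)\<in>carrier A \<times> carrier B. gcd (group.ord A a) (group.ord B b))"
  have split: "rho A ^ order B * rho B ^ order A = rho (A \<times>\<times> B) * D"
    unfolding D_def using rho_DirProd_mult_gcds assms by metis
  have rho_nz: "rho A \<noteq> 0" "rho B \<noteq> 0"
    using rho_neq_0 assms by blast+
  then have nz: "rho (A \<times>\<times> B) \<noteq> 0" "D \<noteq> 0"
    using split by (metis mult_eq_0_iff power_not_zero)+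
  have "D = 1 \<longleftrightarrow> (\<forall>a\<in>carrier A. \<forall>b\<in>carrier B. coprime (group.ord A a) (group.ord B b))"
    using assms(2,4) prod_eq_1_iff[of "carrier A \<times> carrier B"
        "\<lambda>(a, b). gcd (group.ord A a) (group.ord B b)"]
    by (auto simp: D_def coprime_iff_gcd_eq_1)
  then have D: "D = 1 \<longleftrightarrow> gcd (order A) (order B) = 1"
    using coprime_orders_iff_coprime_ords[OF assms] by (simp add: coprime_iff_gcd_eq_1)
  have "Omega_rho A * order B + Omega_rho B * order A
      = Omega (rho A ^ order B * rho B ^ order A)"
    using rho_nz by (simp add: Omega_rho_def Omega_mult Omega_power)
  also have "\<dots> = Omega_rho (A \<times>\<times> B) + Omega D"
    using nz by (simp add: split Omega_rho_def Omega_mult)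
  finally have Omega: "Omega_rho A * order B + Omega_rho B * order A
      = Omega_rho (A \<times>\<times> B) + Omega D" .
  show ?thesis
    unfolding split Omega using nz D Omega_eq_0_iff[OF nz(2)] by (simp add: eq_commute[of _ D])
qed

end
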